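(* Let $1\leq p<\infty$, and let $X$ be a real Banach space. If $Y$ is a Banach space such that every uniformly $p$-convergent subset of $K(X,Y)$ is equicompact, then $C_p(X,Y)=K(X,Y)$.
   Context: $L(X,Y)$ and $K(X,Y)$ are the spaces of bounded linear and of compact operators $X\to Y$. A sequence $(x_n)_n$ in $X$ is weakly $p$-summable if $(x^*(x_n))_n\in\ell_p$ for every $x^*\in X^*$; $\ell_p^w(X)$ denotes the set of such sequences. $C_p(X,Y)$ is the space of $p$-convergent operators, i.e. $T\in L(X,Y)$ with $\|T(x_n)\|\to0$ for all $(x_n)_n\in\ell_p^w(X)$. A set $K\subset L(X,Y)$ is uniformly $p$-convergent if $\lim_n\sup_{T\in K}\|T(x_n)\|=0$ for every $(x_n)_n\in\ell_p^w(X)$. A set $M\subset K(X,Y)$ is equicompact if there is a norm-null sequence $(x_n^* )_n$ in $X^*$ with $\|T(x)\|\leq\sup_n|x_n^*(x)|$ for all $x\in X$ and $T\in M$; equivalently, every bounded sequence $(x_n)_n$ in $X$ has a subsequence $(x_{k_n})_n$ such that $(Tx_{k_n})_n$ converges uniformly for $T\in M$. *)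

theory Defs
  imports "HOL-Analysis.Analysis"
begin

definition compact_ops :: "('a::real_normed_vector \<Rightarrow>\<^sub>L 'b::real_normed_vector) set" where
  "compact_ops = {T. compact (closure (blinfun_apply T ` cball 0 1))}"

definition weakly_p_summable :: "real \<Rightarrow> (nat \<Rightarrow> 'a::real_normed_vector) \<Rightarrow> bool" where
  "weakly_p_summable p x \<longleftrightarrow>
     (\<forall>f :: 'a \<Rightarrow>\<^sub>L real. summable (\<lambda>n. \<bar>blinfun_apply f (x n)\<bar> powr p))"

definition p_convergent_ops ::
    "real \<Rightarrow> ('a::real_normed_vector \<Rightarrow>\<^sub>L 'b::real_normed_vector) set" where
  "p_convergent_ops p =
     {T. \<forall>x. weakly_p_summable p x \<longrightarrow> (\<lambda>n. norm (blinfun_apply T (x n))) \<longlonglongrightarrow> 0}"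

(* The supremum is taken in [0, \<infinity>] because it may be infinite when M is unbounded;
   the supremum over the empty set is 0 there. *)
definition uniformly_p_convergent ::
    "real \<Rightarrow> ('a::real_normed_vector \<Rightarrow>\<^sub>L 'b::real_normed_vector) set \<Rightarrow> bool" where
  "uniformly_p_convergent p M \<longleftrightarrow>
     (\<forall>x. weakly_p_summable p x \<longrightarrow>
        (\<lambda>n. SUP T\<in>M. ennreal (norm (blinfun_apply T (x n)))) \<longlonglongrightarrow> 0)"

(* The real supremum is that of a bounded set, since f is norm-null.  The inequality
   already forces every member of M to be compact. *)
definition equicompact :: "('a::real_normed_vector \<Rightarrow>\<^sub>L 'b::real_normed_vector) set \<Rightarrow> bool" where
  "equicompact M \<longleftrightarrow>
     (\<exists>f :: nat \<Rightarrow> ('a \<Rightarrow>\<^sub>L real). (\<lambda>n. norm (f n)) \<longlonglongrightarrow> 0 \<and>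
        (\<forall>T\<in>M. \<forall>x. norm (blinfun_apply T x) \<le> (SUP n. \<bar>blinfun_apply (f n) x\<bar>)))"

end

theory Submission
  imports Defs
begin

text \<open>
  For a \<open>p\<close>-convergent \<open>T\<close> and a unit vector \<open>y\<close> of \<open>Y\<close>, the rank one operators \<open>x \<mapsto> h (T x) y\<close>
  with \<open>norm h \<le> 1\<close> are bounded at each \<open>x\<close> by \<open>norm (T x)\<close>, hence uniformly \<open>p\<close>-convergent and thus
  equicompact. Taking the supremum over \<open>h\<close> (Hahn--Banach), the norm-null sequence of functionals
  that witnesses this also dominates \<open>T\<close>, so \<open>T\<close> is compact. Conversely, weakly \<open>p\<close>-summable
  sequences are weakly null and bounded, and compact operators map them to norm-null sequences.
  Hahn--Banach is obtained from a minimal sublinear functional, which is necessarily linear.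
\<close>

section \<open>The Hahn--Banach theorem\<close>

text \<open>Homogeneity is an inequality, a form that pointwise infima inherit easily; equality
  follows by rescaling with \<open>1 / t\<close>.\<close>

definition sublinear :: "('a::real_vector \<Rightarrow> real) \<Rightarrow> bool" where
  "sublinear q \<longleftrightarrow> (\<forall>x y. q (x + y) \<le> q x + q y) \<and> (\<forall>t x. 0 \<le> t \<longrightarrow> q (t *\<^sub>R x) \<le> t * q x)"

lemma sublinearI:
  assumes "\<And>x y. q (x + y) \<le> q x + q y" "\<And>t x. 0 \<le> t \<Longrightarrow> q (t *\<^sub>R x) \<le> t * q x"
  shows "sublinear q"
  using assms by (simp add: sublinear_def)

lemma sublinear_add: "sublinear q \<Longrightarrow> q (x + y) \<le> q x + q y"
  by (simp add: sublinear_def)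

lemma sublinear_scaleR_le: "sublinear q \<Longrightarrow> 0 \<le> t \<Longrightarrow> q (t *\<^sub>R x) \<le> t * q x"
  by (simp add: sublinear_def)

lemma sublinear_zero: "sublinear q \<Longrightarrow> q 0 = 0"
  using sublinear_add[of q 0 0] sublinear_scaleR_le[of q 0 0] by simp

lemma sublinear_scaleR:
  assumes "sublinear q" "0 \<le> t"
  shows "q (t *\<^sub>R x) = t * q x"
proof (cases "t = 0")
  case False
  with assms have "q ((1 / t) *\<^sub>R (t *\<^sub>R x)) \<le> (1 / t) * q (t *\<^sub>R x)"
    by (intro sublinear_scaleR_le) auto
  with False assms have "t * q x \<le> q (t *\<^sub>R x)"
    by (simp add: field_simps)
  with sublinear_scaleR_le[OF assms] show ?thesis by (simp add: antisym)
qed (use assms sublinear_zero in auto)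

lemma sublinear_minus_le: "sublinear q \<Longrightarrow> - q (- x) \<le> q x"
  using sublinear_add[of q x "- x"] sublinear_zero[of q] by simp

text \<open>Lowering a sublinear functional so that it becomes linear along a given direction.\<close>

definition linearized_along :: "'a::real_vector \<Rightarrow> ('a \<Rightarrow> real) \<Rightarrow> 'a \<Rightarrow> real" where
  "linearized_along a q x = (INF t\<in>{0..}. q (x + t *\<^sub>R a) - t * q a)"

lemma linearized_along_le:
  assumes "sublinear q" "0 \<le> t"
  shows "linearized_along a q x \<le> q (x + t *\<^sub>R a) - t * q a"
  unfolding linearized_along_def
proof (rule cINF_lower)
  show "bdd_below ((\<lambda>t. q (x + t *\<^sub>R a) - t * q a) ` {0..})"
  proof (rule bdd_belowI2)
    fix s :: real assume "s \<in> {0..}"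
    \<comment> \<open>A real infimum lies below its members only for sets bounded below;
      subadditivity gives the bound \<open>- q (- x)\<close>, independent of
      \<open>s\<close>.\<close>
    then have "s * q a = q ((x + s *\<^sub>R a) + (- x))"
      using sublinear_scaleR[OF assms(1)] by simp
    also have "\<dots> \<le> q (x + s *\<^sub>R a) + q (- x)" by (rule sublinear_add[OF assms(1)])
    finally show "- q (- x) \<le> q (x + s *\<^sub>R a) - s * q a" by simp
  qed
qed (use assms in auto)

lemma linearized_along_greatest:
  assumes "\<And>t. 0 \<le> t \<Longrightarrow> c \<le> q (x + t *\<^sub>R a) - t * q a"
  shows "c \<le> linearized_along a q x"
  unfolding linearized_along_def by (rule cINF_greatest) (use assms in auto)

text \<open>Parameters \<open>t\<close> for \<open>x\<close> and \<open>s\<close> for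
  \<open>y\<close> combine to \<open>t + s\<close> for \<open>x + y\<close>, and \<open>t\<close>
  for \<open>x\<close> becomes \<open>c * t\<close> for \<open>c *\<^sub>R x\<close>.\<close>

lemma sublinear_linearized_along:
  assumes q: "sublinear q"
  shows "sublinear (linearized_along a q)"
proof (rule sublinearI)
  fix x y
  have 1: "linearized_along a q (x + y) \<le> (q (x + t *\<^sub>R a) - t * q a) + (q (y + s *\<^sub>R a) - s * q a)"
    if "0 \<le> t" "0 \<le> s" for s t
  proof -
    have "linearized_along a q (x + y) \<le> q (x + y + (t + s) *\<^sub>R a) - (t + s) * q a"
      using that by (intro linearized_along_le[OF q]) auto
    also have "x + y + (t + s) *\<^sub>R a = (x + t *\<^sub>R a) + (y + s *\<^sub>R a)"
      by (simp add: algebra_simps)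
    also have "q \<dots> \<le> q (x + t *\<^sub>R a) + q (y + s *\<^sub>R a)" by (rule sublinear_add[OF q])
    finally show ?thesis by (simp add: algebra_simps)
  qed
  \<comment> \<open>The two infima are taken one after the other: over \<open>s\<close> with
    \<open>t\<close> fixed, then over \<open>t\<close>.\<close>
  have "linearized_along a q (x + y) - (q (x + t *\<^sub>R a) - t * q a) \<le> linearized_along a q y"
    if "0 \<le> t" for t
    by (rule linearized_along_greatest) (use 1[OF that] in force)
  then have "linearized_along a q (x + y) - linearized_along a q y \<le> linearized_along a q x"
    by (intro linearized_along_greatest) force
  then show "linearized_along a q (x + y) \<le> linearized_along a q x + linearized_along a q y" by simp
next
  fix c :: real and x assume c: "0 \<le> c"
  have 1: "linearized_along a q (c *\<^sub>R x) \<le> c * (q (x + t *\<^sub>R a) - t * q a)" if "0 \<le> t" for t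
  proof -
    have "linearized_along a q (c *\<^sub>R x) \<le> q (c *\<^sub>R x + (c * t) *\<^sub>R a) - (c * t) * q a"
      using that c by (intro linearized_along_le[OF q]) auto
    also have "c *\<^sub>R x + (c * t) *\<^sub>R a = c *\<^sub>R (x + t *\<^sub>R a)" by (simp add: algebra_simps)
    also have "q \<dots> = c * q (x + t *\<^sub>R a)" by (rule sublinear_scaleR[OF q c])
    finally show ?thesis by (simp add: algebra_simps)
  qed
  show "linearized_along a q (c *\<^sub>R x) \<le> c * linearized_along a q x"
  proof (cases "c = 0")
    case True then show ?thesis using 1[of 0] by simp
  next
    case False
    then have "linearized_along a q (c *\<^sub>R x) / c \<le> linearized_along a q x"
      using 1 c by (intro linearized_along_greatest) (simp add: field_simps)
    with False c show ?thesis by (simp add: field_simps)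
  qed
qed

lemma linearized_along_le_self:
  assumes "sublinear q"
  shows "linearized_along a q x \<le> q x"
  using linearized_along_le[OF assms, of 0 a x] by simp

text \<open>Zorn's lemma for the reversed pointwise order: a nonempty chain is bounded by its
  pointwise infimum, which is finite because every member lies above
  \<open>- p (- x)\<close>.\<close>

lemma minimal_sublinear_exists:
  assumes p: "sublinear p"
  obtains q where "sublinear q" "q \<le> p" "\<And>r. sublinear r \<Longrightarrow> r \<le> q \<Longrightarrow> r = q"
proof -
  define A where "A = {q. sublinear q \<and> q \<le> p}"
  have "\<exists>m\<in>A. \<forall>a\<in>A. m \<ge> a \<longrightarrow> a = m"
  proof (rule predicate_Zorn)
    show "partial_order_on A (relation_of (\<ge>) A)"
      by (rule partial_order_on_relation_ofI) auto
    fix C assume C: "C \<in> Chains (relation_of (\<ge>) A)"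
    then have CA: "C \<subseteq> A" by (rule Chains_relation_of)
    have tot: "q \<le> r \<or> r \<le> q" if "q \<in> C" "r \<in> C" for q r
      using C that by (auto simp: Chains_def relation_of_def)
    show "\<exists>u\<in>A. \<forall>a\<in>C. a \<ge> u"
    proof (cases "C = {}")
      case True
      with p show ?thesis by (auto simp: A_def)
    next
      case False
      define u where "u x = (INF q\<in>C. q x)" for x
      have lower: "u x \<le> q x" if "q \<in> C" for q x
        unfolding u_def
      proof (rule cINF_lower[OF bdd_belowI2 that])
        fix r assume "r \<in> C"
        with CA have r: "sublinear r" "r \<le> p" by (auto simp: A_def)
        show "- p (- x) \<le> r x"
          using sublinear_minus_le[OF r(1), of x] le_funD[OF r(2), of "- x"] by linarith
      qed
      have greatest: "c \<le> u x" if "\<And>q. q \<in> C \<Longrightarrow> c \<le> q x" for c x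
        unfolding u_def using False that by (rule cINF_greatest)
      have "sublinear u"
      proof (rule sublinearI)
        fix x y
        have 1: "u (x + y) \<le> q x + r y" if qr: "q \<in> C" "r \<in> C" for q r
        proof -
          \<comment> \<open>The smaller of \<open>q\<close> and \<open>r\<close> serves both
            arguments; for a set that is not a chain the infimum could fail to be
            subadditive.\<close>
          obtain s where s: "s \<in> C" "s \<le> q" "s \<le> r" using tot[OF qr] qr by auto
          have "u (x + y) \<le> s (x + y)" by (rule lower[OF s(1)])
          also have "\<dots> \<le> s x + s y" using s CA by (intro sublinear_add) (auto simp: A_def)
          also have "\<dots> \<le> q x + r y" using le_funD[OF s(2), of x] le_funD[OF s(3), of y] by simp
          finally show ?thesis .
        qed
        have "u (x + y) - q x \<le> u y" if "q \<in> C" for q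
          by (rule greatest) (use 1[OF that] in force)
        then have "u (x + y) - u y \<le> u x" by (intro greatest) force
        then show "u (x + y) \<le> u x + u y" by simp
      next
        fix t :: real and x assume t: "0 \<le> t"
        have 1: "u (t *\<^sub>R x) \<le> t * q x" if "q \<in> C" for q
          using lower[OF that, of "t *\<^sub>R x"] sublinear_scaleR[of q t x] CA that t
          by (auto simp: A_def)
        show "u (t *\<^sub>R x) \<le> t * u x"
        proof (cases "t = 0")
          case True then show ?thesis using 1 \<open>C \<noteq> {}\<close> by auto
        next
          case nz: False
          have "u (t *\<^sub>R x) / t \<le> u x"
            using 1 t nz by (intro greatest) (simp add: field_simps)
          with nz t show ?thesis by (simp add: field_simps)
        qed
      qed
      moreover have "u \<le> p"
        using False lower CA unfolding A_def le_fun_def by (blast intro: order_trans)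
      ultimately show ?thesis
        using lower by (intro bexI[of _ u]) (auto simp: A_def le_fun_def)
    qed
  qed
  then obtain m where "m \<in> A" "\<And>a. a \<in> A \<Longrightarrow> a \<le> m \<Longrightarrow> a = m" by blast
  then show thesis
    by (intro that[of m]) (auto simp: A_def intro: order_trans)
qed

text \<open>Linearizing a minimal \<open>q\<close> along any direction cannot lower it, which forces
  additivity. Starting below \<open>linearized_along a p\<close> rather than \<open>p\<close>
  secures the value at \<open>a\<close>.\<close>

theorem Hahn_Banach_sublinear:
  assumes p: "sublinear p"
  obtains f where "linear f" "\<And>x. f x \<le> p x" "f a = p a"
proof -
  obtain q where q: "sublinear q" "q \<le> linearized_along a p"
    and min: "\<And>r. sublinear r \<Longrightarrow> r \<le> q \<Longrightarrow> r = q"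
    using minimal_sublinear_exists[OF sublinear_linearized_along[OF p]] by blast
  have add: "q (x + y) = q x + q y" for x y
  proof (rule antisym)
    have "linearized_along y q = q"
      using linearized_along_le_self[OF q(1)]
      by (intro min sublinear_linearized_along q) (simp add: le_fun_def)
    then have "q x \<le> q (x + y) - q y"
      using linearized_along_le[OF q(1), of 1 y x] by simp
    then show "q x + q y \<le> q (x + y)" by simp
  qed (rule sublinear_add[OF q(1)])
  have minus: "q (- x) = - q x" for x
    using add[of x "- x"] sublinear_zero[OF q(1)] by simp
  have "linear q"
  proof (rule linearI)
    fix r :: real and x
    show "q (r *\<^sub>R x) = r *\<^sub>R q x"
    proof (cases "0 \<le> r")
      case True then show ?thesis using sublinear_scaleR[OF q(1)] by simp
    next
      case False
      then have "q ((- r) *\<^sub>R x) = (- r) * q x" by (intro sublinear_scaleR[OF q(1)]) simp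
      then show ?thesis using minus[of "r *\<^sub>R x"] by simp
    qed
  qed (rule add)
  moreover have le: "q x \<le> p x" for x
    using le_funD[OF q(2), of x] linearized_along_le_self[OF p, of a x] by linarith
  moreover have "q a = p a"
  proof (rule antisym[OF le])
    \<comment> \<open>The parameter \<open>t = 1\<close> turns the right side into
      \<open>p 0 - p a\<close>, so \<open>q (- a) \<le> - p a\<close>.\<close>
    have "q (- a) \<le> p (- a + 1 *\<^sub>R a) - 1 * p a"
      using le_funD[OF q(2), of "- a"] linearized_along_le[OF p, of 1 a "- a"] by simp
    then show "p a \<le> q a" using minus sublinear_zero[OF p] by simp
  qed
  ultimately show thesis by (rule that)
qed

corollary norming_functional_exists:
  fixes y :: "'a::real_normed_vector"
  obtains f :: "'a \<Rightarrow>\<^sub>L real" where "norm f \<le> 1" "blinfun_apply f y = norm y"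
proof -
  have "sublinear (norm :: 'a \<Rightarrow> real)"
    by (rule sublinearI) (auto simp: norm_triangle_ineq)
  then obtain g :: "'a \<Rightarrow> real" where g: "linear g" "\<And>x. g x \<le> norm x" "g y = norm y"
    by (rule Hahn_Banach_sublinear[where a = y]) blast
  have abs: "\<bar>g x\<bar> \<le> norm x" for x
    using g(2)[of x] g(2)[of "- x"] linear_neg[OF g(1), of x] by simp
  have "bounded_linear g"
    using g(1) abs by (intro bounded_linear_intro[of g 1]) (auto simp: linear_add linear_scale)
  then have ap: "blinfun_apply (Blinfun g) = g" by (rule bounded_linear_Blinfun_apply)
  show thesis
    by (rule that[of "Blinfun g"]) (use g(3) abs in \<open>auto simp: ap intro!: norm_blinfun_bound\<close>)
qed

section \<open>Weakly summable sequences and compact operators\<close>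

text \<open>Uniform boundedness by Baire category in the dual space, which is complete: the closed
  sets \<open>F k\<close> cover it, so one of them contains a ball.\<close>

lemma bounded_range_if_weakly_bounded:
  fixes x :: "nat \<Rightarrow> 'a::real_normed_vector"
  assumes bdd: "\<And>f :: 'a \<Rightarrow>\<^sub>L real. bounded (range (\<lambda>n. blinfun_apply f (x n)))"
  shows "bounded (range x)"
proof -
  define F where "F k = {f :: 'a \<Rightarrow>\<^sub>L real. \<forall>n. \<bar>blinfun_apply f (x n)\<bar> \<le> real k}" for k
  have closed: "closed (F k)" for k
    unfolding F_def
    by (intro closed_Collect_all closed_Collect_le continuous_intros)
  have UN: "(\<Union>k. F k) = UNIV"
  proof (intro equalityI subsetI UNIV_I)
    fix f :: "'a \<Rightarrow>\<^sub>L real"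
    obtain B where "\<And>n. \<bar>blinfun_apply f (x n)\<bar> \<le> B"
      using bdd[of f] by (auto simp: bounded_iff)
    moreover obtain k where "B \<le> real k" using real_arch_simple by blast
    ultimately show "f \<in> (\<Union>k. F k)"
      unfolding F_def by (auto intro: order_trans)
  qed
  have "\<exists>k. interior (F k) \<noteq> {}"
  proof (rule ccontr)
    assume "\<not> ?thesis"
    then have "euclidean interior_of (\<Union>(range F)) = {}"
      by (intro Baire_category_alt disjI1 completely_metrizable_space_euclidean)
        (auto simp: closed)
    then show False using UN by simp
  qed
  then obtain k g e where e: "e > 0" and ball: "cball g e \<subseteq> F k"
    by (metis all_not_in_conv mem_interior_cball)
  \<comment> \<open>Moving from the centre \<open>g\<close> by \<open>e\<close> in the direction of
    a functional norming \<open>x n\<close> stays in \<open>F k\<close>; the difference of two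
    values bounded by \<open>k\<close> is \<open>e * norm (x n)\<close>.\<close>
  have "norm (x n) \<le> 2 * real k / e" for n
  proof -
    obtain f :: "'a \<Rightarrow>\<^sub>L real" where f: "norm f \<le> 1" "blinfun_apply f (x n) = norm (x n)"
      by (rule norming_functional_exists)
    have "g + e *\<^sub>R f \<in> F k" "g \<in> F k"
      using ball e f(1) by (auto simp: subset_iff dist_norm)
    then have "\<bar>blinfun_apply (g + e *\<^sub>R f) (x n)\<bar> \<le> real k" "\<bar>blinfun_apply g (x n)\<bar> \<le> real k"
      unfolding F_def by blast+
    moreover have "blinfun_apply (g + e *\<^sub>R f) (x n) = blinfun_apply g (x n) + e * norm (x n)"
      by (simp add: blinfun.add_left blinfun.scaleR_left f(2))
    ultimately have "e * norm (x n) \<le> 2 * real k" by linarith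
    with e show ?thesis by (simp add: field_simps)
  qed
  then show ?thesis by (auto simp: bounded_iff)
qed

section \<open>Weakly p-summable sequences are weakly null, and compact operators are
  p-convergent\<close>

lemma weakly_p_summable_tendsto_0:
  fixes f :: "'a::real_normed_vector \<Rightarrow>\<^sub>L real"
  assumes "weakly_p_summable p x" "0 < p"
  shows "(\<lambda>n. blinfun_apply f (x n)) \<longlonglongrightarrow> 0"
proof -
  have "(\<lambda>n. \<bar>blinfun_apply f (x n)\<bar> powr p) \<longlonglongrightarrow> 0"
    using assms by (intro summable_LIMSEQ_zero) (simp add: weakly_p_summable_def)
  then have "(\<lambda>n. (\<bar>blinfun_apply f (x n)\<bar> powr p) powr (1 / p)) \<longlonglongrightarrow> 0 powr (1 / p)"
    using assms by (intro tendsto_powr2) auto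
  then show ?thesis
    using assms by (simp add: powr_powr tendsto_rabs_zero_iff)
qed

lemma compact_op_bounded_subsequence:
  fixes x :: "nat \<Rightarrow> 'a::real_normed_vector"
  assumes T: "T \<in> compact_ops" and bdd: "bounded (range x)"
  obtains l r where "strict_mono r" "(\<lambda>n. blinfun_apply T (x (r n))) \<longlonglongrightarrow> l"
proof -
  obtain B where B: "B > 0" "\<And>n. norm (x n) \<le> B"
    using bdd by (auto simp: bounded_pos)
  define K where "K = closure (blinfun_apply T ` cball 0 1)"
  have "seq_compact K"
    using T by (simp add: K_def compact_ops_def compact_imp_seq_compact)
  moreover have "\<forall>n. blinfun_apply T ((1 / B) *\<^sub>R x n) \<in> K"
    unfolding K_def using B by (intro allI closure_subset[THEN subsetD] imageI) (simp add: field_simps)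
  ultimately obtain l r where lr: "strict_mono r"
      "((\<lambda>n. blinfun_apply T ((1 / B) *\<^sub>R x n)) \<circ> r) \<longlonglongrightarrow> l"
    by (rule seq_compactE) blast
  have "(\<lambda>n. B *\<^sub>R blinfun_apply T ((1 / B) *\<^sub>R x (r n))) \<longlonglongrightarrow> B *\<^sub>R l"
    by (intro tendsto_intros lr(2)[unfolded o_def])
  then have "(\<lambda>n. blinfun_apply T (x (r n))) \<longlonglongrightarrow> B *\<^sub>R l"
    using B(1) by (simp add: blinfun.scaleR_right)
  with lr(1) show thesis by (rule that)
qed

text \<open>Were the images not norm-null, some subsequence of them would stay outside a ball around
  0 and, by compactness, converge to a nonzero \<open>l\<close>; weak nullity excludes this.\<close>

lemma compact_ops_subset_p_convergent_ops:
  assumes p: "0 < p"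
  shows "compact_ops \<subseteq> p_convergent_ops p"
proof
  fix T :: "'a \<Rightarrow>\<^sub>L 'b" assume T: "T \<in> compact_ops"
  have "(\<lambda>n. norm (blinfun_apply T (x n))) \<longlonglongrightarrow> 0" if x: "weakly_p_summable p x" for x
  proof (rule ccontr)
    assume "\<not> ?thesis"
    then obtain e where e: "e > 0" "\<And>N. \<exists>n\<ge>N. e \<le> norm (blinfun_apply T (x n))"
      by (auto simp: LIMSEQ_iff not_less)
    have "infinite {n. e \<le> norm (blinfun_apply T (x n))}"
      unfolding infinite_nat_iff_unbounded_le mem_Collect_eq using e(2) by blast
    from infinite_enumerate[OF this]
    obtain s :: "nat \<Rightarrow> nat" where s: "strict_mono s" "\<And>n. e \<le> norm (blinfun_apply T (x (s n)))"
      by auto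
    have null: "(\<lambda>n. blinfun_apply f (x n)) \<longlonglongrightarrow> 0" for f :: "'a \<Rightarrow>\<^sub>L real"
      by (rule weakly_p_summable_tendsto_0[OF x p])
    have "bounded (range x)"
      by (rule bounded_range_if_weakly_bounded) (rule convergent_imp_bounded[OF null])
    then have "bounded (range (x \<circ> s))"
      by (rule bounded_subset) auto
    then obtain l r where r: "strict_mono r" and l: "(\<lambda>n. blinfun_apply T ((x \<circ> s) (r n))) \<longlonglongrightarrow> l"
      by (rule compact_op_bounded_subsequence[OF T])
    obtain h :: "'b \<Rightarrow>\<^sub>L real" where h: "blinfun_apply h l = norm l"
      by (rule norming_functional_exists)
    have "(\<lambda>n. blinfun_apply h (blinfun_apply T ((x \<circ> s) (r n)))) \<longlonglongrightarrow> norm l"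
      unfolding h[symmetric]
      by (intro tendsto_intros l)
    \<comment> \<open>\<open>h o\<^sub>L T\<close> is a functional on the domain, so weak nullity of
      \<open>x\<close> applies to it.\<close>
    moreover have "(\<lambda>n. blinfun_apply h (blinfun_apply T ((x \<circ> s) (r n)))) \<longlonglongrightarrow> 0"
      using LIMSEQ_subseq_LIMSEQ[OF null[of "h o\<^sub>L T"] strict_mono_o[OF s(1) r]] by (simp add: o_def)
    ultimately have "l = 0"
      by (metis LIMSEQ_unique norm_eq_zero)
    moreover have "e \<le> norm l"
      using tendsto_norm[OF l] s(2) by (intro LIMSEQ_le_const) auto
    ultimately show False using e(1) by simp
  qed
  then show "T \<in> p_convergent_ops p" by (simp add: p_convergent_ops_def)
qed

section \<open>Equicompact sets\<close>

lemma totally_bounded_imp_compact_closure: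
  fixes S :: "'a::complete_space set"
  assumes "\<And>e. e > 0 \<Longrightarrow> \<exists>K. finite K \<and> K \<subseteq> S \<and> S \<subseteq> (\<Union>x\<in>K. ball x e)"
  shows "compact (closure S)"
proof -
  have "Met_TC.mtotally_bounded S" using assms by (simp add: Met_TC.mtotally_bounded_def)
  moreover have "Met_TC.mcomplete TYPE('a)" by (simp add: complete_UNIV)
  ultimately show ?thesis
    using Met_TC.mtotally_bounded_eq_compact_closure_of[of S] by simp
qed

text \<open>Up to a given \<open>e\<close>, only finitely many of the dominating functionals matter
  on the unit ball. Their rounded values split the ball into finitely many cells on which
  \<open>T\<close> varies by less than \<open>e\<close>, so the image is totally bounded.\<close>

lemma equicompact_imp_compact_op:
  fixes T :: "'a::real_normed_vector \<Rightarrow>\<^sub>L 'b::banach"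
  assumes "equicompact M" "T \<in> M"
  shows "T \<in> compact_ops"
proof -
  obtain f :: "nat \<Rightarrow> 'a \<Rightarrow>\<^sub>L real" where null: "(\<lambda>n. norm (f n)) \<longlonglongrightarrow> 0"
    and dom: "\<And>x. norm (blinfun_apply T x) \<le> (SUP n. \<bar>blinfun_apply (f n) x\<bar>)"
    using assms unfolding equicompact_def by blast
  obtain K where K: "\<And>n. norm (f n) \<le> K"
    using convergent_imp_bounded[OF null] by (auto simp: bounded_iff)
  have "\<exists>C. finite C \<and> C \<subseteq> blinfun_apply T ` cball 0 1 \<and>
      blinfun_apply T ` cball 0 1 \<subseteq> (\<Union>y\<in>C. ball y e)" if e: "e > 0" for e
  proof -
    \<comment> \<open>Two points of the unit ball differ by norm at most 2, so the tail functionals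
      separate them by at most \<open>e / 2\<close>.\<close>
    obtain N where N: "\<And>n. n \<ge> N \<Longrightarrow> norm (f n) < e / 4"
      using LIMSEQ_D[OF null, of "e / 4"] e by auto
    \<comment> \<open>\<open>c x\<close> labels the cell of \<open>x\<close> in a grid of mesh
      \<open>e / 2\<close>. Restricting to \<open>{..<N}\<close> fixes the values elsewhere, so that
      the labels lie in a finite product set.\<close>
    define c where "c x = (\<lambda>i\<in>{..<N}. \<lfloor>blinfun_apply (f i) x / (e / 2)\<rfloor>)" for x
    define b where "b = K / (e / 2)"
    have small: "norm (blinfun_apply T x - blinfun_apply T y) < e"
      if "x \<in> cball 0 1" "y \<in> cball 0 1" "c x = c y" for x y
    proof -
      have "\<bar>blinfun_apply (f n) (x - y)\<bar> \<le> e / 2" for n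
      proof (cases "n < N")
        case True
        with fun_cong[OF that(3), of n]
        have "\<lfloor>blinfun_apply (f n) x / (e / 2)\<rfloor> = \<lfloor>blinfun_apply (f n) y / (e / 2)\<rfloor>"
          by (simp add: c_def)
        then have "\<bar>blinfun_apply (f n) x / (e / 2) - blinfun_apply (f n) y / (e / 2)\<bar> \<le> 1" by linarith
        then have "\<bar>(blinfun_apply (f n) x - blinfun_apply (f n) y) / (e / 2)\<bar> \<le> 1"
          by (simp only: diff_divide_distrib)
        then have "\<bar>blinfun_apply (f n) x - blinfun_apply (f n) y\<bar> / (e / 2) \<le> 1"
          using e by (subst abs_div_pos) auto
        then show ?thesis
          using e by (simp add: blinfun.diff_right pos_divide_le_eq)
      next
        case False
        have "norm (blinfun_apply (f n) (x - y)) \<le> norm (f n) * norm (x - y)"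
          by (rule norm_blinfun)
        also have "\<dots> \<le> (e / 4) * 2"
          using N[of n] False that norm_triangle_ineq4[of x y] e
          by (intro mult_mono) (auto simp: dist_norm)
        finally show ?thesis by simp
      qed
      \<comment> \<open>A supremum keeps only the weak inequality; the slack between
        \<open>e / 2\<close> and \<open>e\<close> restores the strict one needed for open
        balls.\<close>
      then have "(SUP n. \<bar>blinfun_apply (f n) (x - y)\<bar>) \<le> e / 2"
        by (intro cSUP_least) auto
      with dom[of "x - y"] e show ?thesis by (simp add: blinfun.diff_right)
    qed
    have "c x \<in> {..<N} \<rightarrow>\<^sub>E {\<lfloor>- b\<rfloor>..\<lfloor>b\<rfloor>}" if "x \<in> cball 0 1" for x
    proof -
      have "\<bar>blinfun_apply (f i) x / (e / 2)\<bar> \<le> b" for i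
      proof -
        have "norm (blinfun_apply (f i) x) \<le> norm (f i) * norm x" by (rule norm_blinfun)
        also have "\<dots> \<le> K * 1"
          using that K[of i] order_trans[OF norm_ge_zero K[of i]] by (intro mult_mono) auto
        finally show ?thesis using e by (simp add: b_def abs_divide divide_right_mono)
      qed
      then have "\<lfloor>blinfun_apply (f i) x / (e / 2)\<rfloor> \<in> {\<lfloor>- b\<rfloor>..\<lfloor>b\<rfloor>}" for i
        unfolding abs_le_iff atLeastAtMost_iff by (metis floor_mono minus_le_iff)
      then show ?thesis unfolding c_def by (intro restrict_PiE_iff[THEN iffD2] ballI)
    qed
    then have "c ` cball 0 1 \<subseteq> {..<N} \<rightarrow>\<^sub>E {\<lfloor>- b\<rfloor>..\<lfloor>b\<rfloor>}" by blast
    then have "finite (c ` cball 0 1)"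
      by (rule finite_subset) (intro finite_PiE ballI; simp)
    \<comment> \<open>\<open>R\<close> is a finite set of representatives meeting every nonempty
      cell; its image is the required net.\<close>
    from finite_subset_image[OF this subset_refl]
    obtain R where R: "R \<subseteq> cball 0 1" "finite R" "c ` cball 0 1 = c ` R"
      by blast
    show ?thesis
    proof (intro exI[of _ "blinfun_apply T ` R"] conjI subsetI)
      fix y assume "y \<in> blinfun_apply T ` cball 0 1"
      then obtain x where x: "x \<in> cball 0 1" "y = blinfun_apply T x" by blast
      then have "c x \<in> c ` R" using R(3) by blast
      then obtain z where "z \<in> R" "c z = c x" by (metis imageE)
      then show "y \<in> (\<Union>y\<in>blinfun_apply T ` R. ball y e)"
        using small[of z x] x R(1) by (force simp: dist_norm subset_iff)
    qed (use R in auto)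
  qed
  then show ?thesis
    unfolding compact_ops_def by (simp add: totally_bounded_imp_compact_closure)
qed

text \<open>The unit ball is mapped into the compact set of multiples \<open>r *\<^sub>R y\<close>
  with \<open>\<bar>r\<bar> \<le> norm g\<close>.\<close>

lemma rank_one_compact_op: "blinfun_scaleR_left y o\<^sub>L g \<in> compact_ops"
proof -
  define A where "A = blinfun_apply (blinfun_scaleR_left y o\<^sub>L g) ` cball 0 1"
  define B where "B = (\<lambda>r. r *\<^sub>R y) ` cball 0 (norm g)"
  have "A \<subseteq> B"
    unfolding A_def
  proof (rule image_subsetI)
    fix x :: 'a assume "x \<in> cball 0 1"
    then have "norm (blinfun_apply g x) \<le> norm g"
      using norm_blinfun[of g x] mult_left_mono[of "norm x" 1 "norm g"] by simp
    then show "blinfun_apply (blinfun_scaleR_left y o\<^sub>L g) x \<in> B"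
      unfolding B_def by (intro image_eqI[of _ _ "blinfun_apply g x"]) auto
  qed
  moreover have B: "compact B"
    unfolding B_def by (intro compact_continuous_image continuous_intros) auto
  ultimately have "closure A \<inter> B = closure A"
    by (intro Int_absorb2 closure_minimal compact_imp_closed)
  with closed_Int_compact[OF closed_closure B, of A] show ?thesis
    by (simp add: compact_ops_def A_def)
qed

section \<open>Equality of the p-convergent and the compact operators\<close>

theorem theorem3p2:
  fixes p :: real
  assumes "1 \<le> p"
    and "\<And>M :: ('a::banach \<Rightarrow>\<^sub>L 'b::banach) set.
           M \<subseteq> compact_ops \<Longrightarrow> uniformly_p_convergent p M \<Longrightarrow> equicompact M"
  shows "(p_convergent_ops p :: ('a \<Rightarrow>\<^sub>L 'b) set) = compact_ops"
proof
  show "(compact_ops :: ('a \<Rightarrow>\<^sub>L 'b) set) \<subseteq> p_convergent_ops p"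
    using assms(1) by (intro compact_ops_subset_p_convergent_ops) simp
  show "(p_convergent_ops p :: ('a \<Rightarrow>\<^sub>L 'b) set) \<subseteq> compact_ops"
  proof
    fix T :: "'a \<Rightarrow>\<^sub>L 'b" assume T: "T \<in> p_convergent_ops p"
    show "T \<in> compact_ops"
    proof (cases "\<exists>y :: 'b. y \<noteq> 0")
      \<comment> \<open>The zero space contains no unit vector and is treated separately; there
        \<open>T\<close> vanishes.\<close>
      case False
      then have "blinfun_apply T = (\<lambda>_. 0)" by blast
      then show ?thesis by (simp add: compact_ops_def image_constant_conv)
    next
      case True
      then obtain z :: 'b where "z \<noteq> 0" by blast
      define y where "y = sgn z"
      have y: "norm y = 1" using \<open>z \<noteq> 0\<close> by (simp add: y_def norm_sgn)
      \<comment> \<open>The dual unit ball composed with \<open>T\<close>, placed in the codomain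
        along \<open>y\<close>; as \<open>norm y = 1\<close>, the norm of a value is
        \<open>\<bar>h (T x)\<bar>\<close>.\<close>
      define M where "M = {blinfun_scaleR_left y o\<^sub>L (h o\<^sub>L T) | h. norm h \<le> 1}"
      have "M \<subseteq> compact_ops" by (auto simp: M_def rank_one_compact_op)
      moreover have "uniformly_p_convergent p M"
        unfolding uniformly_p_convergent_def
      proof (intro allI impI)
        fix x :: "nat \<Rightarrow> 'a" assume "weakly_p_summable p x"
        with T have "(\<lambda>n. norm (blinfun_apply T (x n))) \<longlonglongrightarrow> 0" by (simp add: p_convergent_ops_def)
        then have lim: "(\<lambda>n. ennreal (norm (blinfun_apply T (x n)))) \<longlonglongrightarrow> 0"
          by (metis ennreal_0 tendsto_ennrealI)
        have "(SUP S\<in>M. ennreal (norm (blinfun_apply S (x n)))) \<le> ennreal (norm (blinfun_apply T (x n)))" for n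
        proof (rule SUP_least)
          fix S assume "S \<in> M"
          then obtain h where h: "norm h \<le> 1" "S = blinfun_scaleR_left y o\<^sub>L (h o\<^sub>L T)"
            by (auto simp: M_def)
          have "norm (blinfun_apply h (blinfun_apply T (x n))) \<le> norm (blinfun_apply T (x n))"
            using norm_blinfun[of h "blinfun_apply T (x n)"]
              mult_right_mono[OF h(1), of "norm (blinfun_apply T (x n))"] by simp
          then show "ennreal (norm (blinfun_apply S (x n))) \<le> ennreal (norm (blinfun_apply T (x n)))"
            using h(2) y by (intro ennreal_leI) simp
        qed
        then show "(\<lambda>n. SUP S\<in>M. ennreal (norm (blinfun_apply S (x n)))) \<longlonglongrightarrow> 0"
          by (intro tendsto_sandwich[OF _ _ tendsto_const lim]) auto
      qed
      ultimately have "equicompact M" by (rule assms(2))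
      then obtain f :: "nat \<Rightarrow> 'a \<Rightarrow>\<^sub>L real" where f: "(\<lambda>n. norm (f n)) \<longlonglongrightarrow> 0"
        and dom: "\<And>S x. S \<in> M \<Longrightarrow> norm (blinfun_apply S x) \<le> (SUP n. \<bar>blinfun_apply (f n) x\<bar>)"
        unfolding equicompact_def by blast
      have "norm (blinfun_apply T x) \<le> (SUP n. \<bar>blinfun_apply (f n) x\<bar>)" for x
      proof -
        \<comment> \<open>The choice of \<open>h\<close> depends on \<open>x\<close>, but the
          dominating sequence \<open>f\<close> is common to all of \<open>M\<close>, so one sequence
          controls \<open>T\<close> at every \<open>x\<close>.\<close>
        obtain h where h: "norm h \<le> 1" "blinfun_apply h (blinfun_apply T x) = norm (blinfun_apply T x)"
          by (rule norming_functional_exists)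
        then have "blinfun_scaleR_left y o\<^sub>L (h o\<^sub>L T) \<in> M" by (auto simp: M_def)
        from dom[OF this, of x] show ?thesis using h(2) y by simp
      qed
      with f have "equicompact {T}" by (auto simp: equicompact_def)
      then show ?thesis by (rule equicompact_imp_compact_op) simp
    qed
  qed
qed

end
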